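(* Let $\alpha:\mathbb{R}[x,y,z]\to\mathbb{R}[x,y,z]$ be a (unital) $\mathbb{R}$-algebra morphism such that $\alpha(\{f,g,h\})=\{\alpha(f),\alpha(g),\alpha(h)\}$ for all $f,g,h\in\mathbb{R}[x,y,z]$, so that $\alpha$ gives a structure of ternary Hom-Nambu-Poisson algebra $(\mathbb{R}[x,y,z],\ \cdot_{\alpha}=\alpha\circ\cdot,\ \{\cdot,\cdot,\cdot\}_{\alpha}=\alpha\circ\{\cdot,\cdot,\cdot\},\ \alpha)$. Then $\alpha$ satisfies $$1-\left|\begin{array}{ccc} \frac{\partial \alpha(x)}{\partial x} & \frac{\partial \alpha(x)}{\partial y} & \frac{\partial \alpha(x)}{\partial z}\\ \frac{\partial \alpha(y)}{\partial x} & \frac{\partial \alpha(y)}{\partial y} & \frac{\partial \alpha(y)}{\partial z}\\ \frac{\partial \alpha(z)}{\partial x} & \frac{\partial \alpha(z)}{\partial y} & \frac{\partial \alpha(z)}{\partial z} \end{array}\right|=0.$$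
   Context: On the polynomial algebra $\mathbb{R}[x,y,z]$ with its usual product $\cdot$, the ternary bracket is the Jacobian determinant $$\{f,g,h\}=\left|\begin{array}{ccc} \frac{\partial f}{\partial x} & \frac{\partial f}{\partial y} & \frac{\partial f}{\partial z}\\ \frac{\partial g}{\partial x} & \frac{\partial g}{\partial y} & \frac{\partial g}{\partial z}\\ \frac{\partial h}{\partial x} & \frac{\partial h}{\partial y} & \frac{\partial h}{\partial z} \end{array}\right|.$$ A ternary Hom-Nambu-Poisson algebra $(A,\mu,\{\cdot,\cdot,\cdot\},\alpha)$ is a vector space with a commutative bilinear map $\mu$, a skew-symmetric trilinear bracket and a linear map $\alpha:A\to A$ satisfying, for all elements of $A$: $\mu(\alpha(x),\mu(y,z))=\mu(\mu(x,y),\alpha(z))$; $\{\alpha(x_1),\alpha(x_2),\{x_3,x_4,x_5\}\}=\{\{x_1,x_2,x_3\},\alpha(x_4),\alpha(x_5)\}+\{\alpha(x_3),\{x_1,x_2,x_4\},\alpha(x_5)\}+\{\alpha(x_3),\alpha(x_4),\{x_1,x_2,x_5\}\}$; and $\{\mu(x_1,x_2),\alpha(x_3),\alpha(x_4)\}=\mu(\alpha(x_1),\{x_2,x_3,x_4\})+\mu(\{x_1,x_3,x_4\},\alpha(x_2))$. *)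

theory Defs
  imports "HOL-Analysis.Analysis" "HOL-Library.Poly_Mapping"
begin

text \<open>
  The algebra $R[x,y,z]$ is the monoid algebra of finitely supported functions from exponents
  (\<open>m :: 3 \<Rightarrow>\<^sub>0 nat\<close> stands for the monomial with exponent \<open>lookup m v\<close> at the variable \<open>v\<close>) to
  real coefficients; the library's \<open>+\<close>, \<open>*\<close> and \<open>1\<close> on this type are the usual ones on polynomials.
  The three variables are indexed by the type \<open>3\<close>, in which the numerals \<open>3\<close> and \<open>0\<close> coincide.
\<close>

type_synonym poly3 = "(3 \<Rightarrow>\<^sub>0 nat) \<Rightarrow>\<^sub>0 real"

definition var :: "3 \<Rightarrow> poly3" where
  "var v = Poly_Mapping.single (Poly_Mapping.single v 1) 1"

definition scale3 :: "real \<Rightarrow> poly3 \<Rightarrow> poly3" where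
  "scale3 c p = Poly_Mapping.single 0 c * p"

text \<open>
  Termwise differentiation with respect to the variable \<open>v\<close>. If \<open>v\<close> does not occur in \<open>m\<close>, the
  truncated difference \<open>m - single v 1\<close> is harmless because the coefficient is zero.
\<close>

definition pdiff :: "3 \<Rightarrow> poly3 \<Rightarrow> poly3" where
  "pdiff v p = (\<Sum>m\<in>Poly_Mapping.keys p.
     Poly_Mapping.single (m - Poly_Mapping.single v 1)
       (real (Poly_Mapping.lookup m v) * Poly_Mapping.lookup p m))"

definition jacobian_matrix :: "poly3 \<Rightarrow> poly3 \<Rightarrow> poly3 \<Rightarrow> poly3^3^3" where
  "jacobian_matrix f g h =
     vector [vector [pdiff 1 f, pdiff 2 f, pdiff 3 f],
             vector [pdiff 1 g, pdiff 2 g, pdiff 3 g],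
             vector [pdiff 1 h, pdiff 2 h, pdiff 3 h]]"

definition jacobian_bracket :: "poly3 \<Rightarrow> poly3 \<Rightarrow> poly3 \<Rightarrow> poly3" where
  "jacobian_bracket f g h = det (jacobian_matrix f g h)"

text \<open>
  Linearity of \<open>mu\<close> and \<open>br\<close> is only demanded in the first argument, and skew-symmetry of \<open>br\<close> only
  for adjacent transpositions: the remaining cases follow from (skew-)symmetry.
\<close>

locale ternary_hom_nambu_poisson = vector_space scale
  for scale :: "'k::field \<Rightarrow> 'a::ab_group_add \<Rightarrow> 'a" +
  fixes mu :: "'a \<Rightarrow> 'a \<Rightarrow> 'a"
    and br :: "'a \<Rightarrow> 'a \<Rightarrow> 'a \<Rightarrow> 'a"
    and \<alpha> :: "'a \<Rightarrow> 'a"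
  assumes mu_linear: "\<And>b. Vector_Spaces.linear scale scale (\<lambda>a. mu a b)"
    and mu_commute: "\<And>a b. mu a b = mu b a"
    and br_linear: "\<And>b c. Vector_Spaces.linear scale scale (\<lambda>a. br a b c)"
    and br_skew12: "\<And>a b c. br b a c = - br a b c"
    and br_skew23: "\<And>a b c. br a c b = - br a b c"
    and alpha_linear: "Vector_Spaces.linear scale scale \<alpha>"
    and hom_assoc: "\<And>a b c. mu (\<alpha> a) (mu b c) = mu (mu a b) (\<alpha> c)"
    and hom_nambu: "\<And>a1 a2 a3 a4 a5.
      br (\<alpha> a1) (\<alpha> a2) (br a3 a4 a5) =
        br (br a1 a2 a3) (\<alpha> a4) (\<alpha> a5)
        + br (\<alpha> a3) (br a1 a2 a4) (\<alpha> a5)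
        + br (\<alpha> a3) (\<alpha> a4) (br a1 a2 a5)"
    and hom_leibniz: "\<And>a1 a2 a3 a4.
      br (mu a1 a2) (\<alpha> a3) (\<alpha> a4) = mu (\<alpha> a1) (br a2 a3 a4) + mu (br a1 a3 a4) (\<alpha> a2)"

lemma vector_space_scale3: "vector_space scale3"
  by unfold_locales
    (simp_all add: scale3_def algebra_simps single_add mult_single flip: mult.assoc single_one)

end

theory Submission
  imports Defs
begin

text \<open>
  A vector field \<open>X = (u, v, w)\<close> acts on Jacobians by \<open>X {f,g,h} = {X f,g,h} + {f,X g,h} + {f,g,X h} -
  (div X) {f,g,h}\<close>. For \<open>X = {a,b,\<cdot>}\<close> the divergence vanishes because partial derivatives commute,
  which is the fundamental identity of the Nambu bracket. Twisting by a morphism preserves the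
  identities, and \<open>{x,y,z} = 1\<close> forces \<open>{\<alpha> x,\<alpha> y,\<alpha> z} = \<alpha> 1 = 1\<close>.
\<close>

lemma pdiff_single:
  "pdiff v (Poly_Mapping.single m c) =
    Poly_Mapping.single (m - Poly_Mapping.single v 1) (real (Poly_Mapping.lookup m v) * c)"
  by (simp add: pdiff_def)

lemma pdiff_single_0: "pdiff v (Poly_Mapping.single 0 c) = 0"
  by (simp add: pdiff_single)

text \<open>The only exponent that \<open>pdiff v\<close> sends to \<open>m\<close> with a nonzero
  factor is \<open>m + single v 1\<close>. This coefficientwise form makes additivity and
  commutation easy to check.\<close>

lemma lookup_pdiff:
  "Poly_Mapping.lookup (pdiff v p) m =
    real (Suc (Poly_Mapping.lookup m v)) * Poly_Mapping.lookup p (m + Poly_Mapping.single v 1)"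
proof -
  \<comment> \<open>Truncated subtraction can be undone only if \<open>v\<close> occurs in
    \<open>k\<close>; all other terms of the sum carry the factor 0.\<close>
  have shift: "k - Poly_Mapping.single v 1 = m \<longleftrightarrow> k = m + Poly_Mapping.single v 1"
    if "Poly_Mapping.lookup k v \<noteq> 0" for k :: "3 \<Rightarrow>\<^sub>0 nat"
  proof
    assume eq: "k - Poly_Mapping.single v 1 = m"
    show "k = m + Poly_Mapping.single v 1"
      by (rule poly_mapping_eqI)
        (use that in \<open>auto simp: lookup_minus lookup_add lookup_single when_def simp flip: eq\<close>)
  qed simp
  have "Poly_Mapping.lookup (pdiff v p) m = (\<Sum>k\<in>Poly_Mapping.keys p.
      if k = m + Poly_Mapping.single v 1
      then real (Poly_Mapping.lookup k v) * Poly_Mapping.lookup p k else 0)"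
    unfolding pdiff_def lookup_sum
    by (rule sum.cong) (use shift in \<open>auto simp: lookup_single when_def\<close>)
  then show ?thesis
    by (auto simp: lookup_add not_in_keys_iff_lookup_eq_zero)
qed

lemma pdiff_add: "pdiff v (p + q) = pdiff v p + pdiff v q"
  by (rule poly_mapping_eqI) (simp add: lookup_pdiff lookup_add algebra_simps)

lemma pdiff_diff: "pdiff v (p - q) = pdiff v p - pdiff v q"
  by (rule poly_mapping_eqI) (simp add: lookup_pdiff lookup_minus algebra_simps)

lemma pdiff_0 [simp]: "pdiff v 0 = 0"
  by (simp add: pdiff_def)

lemma pdiff_sum: "pdiff v (sum f A) = (\<Sum>a\<in>A. pdiff v (f a))"
  by (induction A rule: infinite_finite_induct) (simp_all add: pdiff_add)

text \<open>For distinct \<open>v\<close> and \<open>w\<close>, either order multiplies the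
  coefficient at \<open>m + single v 1 + single w 1\<close> by the same two factors.\<close>

lemma pdiff_commute: "pdiff v (pdiff w p) = pdiff w (pdiff v p)"
  by (rule poly_mapping_eqI) (auto simp: lookup_pdiff lookup_add lookup_single when_def ac_simps)

lemma pdiff_mult_single:
  "pdiff v (Poly_Mapping.single m c * Poly_Mapping.single n d) =
    Poly_Mapping.single m c * pdiff v (Poly_Mapping.single n d)
    + pdiff v (Poly_Mapping.single m c) * Poly_Mapping.single n d"
proof -
  have shift: "k + l - Poly_Mapping.single v 1 = k - Poly_Mapping.single v 1 + l"
    if "Poly_Mapping.lookup k v \<noteq> 0" for k l :: "3 \<Rightarrow>\<^sub>0 nat"
    by (rule poly_mapping_eqI)
      (use that in \<open>auto simp: lookup_minus lookup_add lookup_single when_def\<close>)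
  show ?thesis
    \<comment> \<open>The lowered exponent may be attributed to either factor in which
      \<open>v\<close> occurs; a factor without \<open>v\<close> contributes a zero
      derivative.\<close>
    using shift[of m n] shift[of n m]
    by (cases "Poly_Mapping.lookup m v = 0"; cases "Poly_Mapping.lookup n v = 0")
      (simp_all add: pdiff_single mult_single lookup_add algebra_simps flip: single_add)
qed

lemma sum_single_keys:
  "(\<Sum>k\<in>Poly_Mapping.keys p. Poly_Mapping.single k (Poly_Mapping.lookup p k)) = p"
proof (rule poly_mapping_eqI)
  fix m
  have "(\<Sum>k\<in>Poly_Mapping.keys p. Poly_Mapping.lookup p k when k = m) =
      (\<Sum>k\<in>Poly_Mapping.keys p. if k = m then Poly_Mapping.lookup p k else 0)"
    by (rule sum.cong) (simp_all add: when_def)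
  then show "Poly_Mapping.lookup
      (\<Sum>k\<in>Poly_Mapping.keys p. Poly_Mapping.single k (Poly_Mapping.lookup p k)) m =
    Poly_Mapping.lookup p m"
    by (auto simp: lookup_sum lookup_single not_in_keys_iff_lookup_eq_zero)
qed

text \<open>Both sides are bilinear in \<open>p\<close> and \<open>q\<close>, so splitting them into
  monomials reduces the claim to \<open>pdiff_mult_single\<close>.\<close>

lemma pdiff_mult: "pdiff v (p * q) = p * pdiff v q + pdiff v p * q"
proof -
  define s where "s r = (\<lambda>k. Poly_Mapping.single k (Poly_Mapping.lookup r k))" for r :: poly3
  define P where "P = Poly_Mapping.keys p"
  define Q where "Q = Poly_Mapping.keys q"
  have pq: "p = sum (s p) P" "q = sum (s q) Q"
    by (simp_all add: s_def P_def Q_def sum_single_keys)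
  have "pdiff v (sum (s p) P * sum (s q) Q) =
      sum (s p) P * pdiff v (sum (s q) Q) + pdiff v (sum (s p) P) * sum (s q) Q"
    by (simp add: sum_product pdiff_sum s_def pdiff_mult_single sum.distrib)
  then show ?thesis
    by (simp flip: pq)
qed

lemmas pdiff_simps = pdiff_add pdiff_diff pdiff_mult

text \<open>The rule of Sarrus turns bracket identities into ring identities between partial
  derivatives.\<close>

lemma jacobian_bracket_expand:
  "jacobian_bracket f g h =
    pdiff 1 f * pdiff 2 g * pdiff 3 h + pdiff 2 f * pdiff 3 g * pdiff 1 h
    + pdiff 3 f * pdiff 1 g * pdiff 2 h - pdiff 1 f * pdiff 3 g * pdiff 2 h
    - pdiff 2 f * pdiff 1 g * pdiff 3 h - pdiff 3 f * pdiff 2 g * pdiff 1 h"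
  by (simp add: jacobian_bracket_def jacobian_matrix_def det_3)

lemma jacobian_bracket_add:
  "jacobian_bracket (f + f') g h = jacobian_bracket f g h + jacobian_bracket f' g h"
  by (simp add: jacobian_bracket_expand pdiff_simps algebra_simps)

lemma jacobian_bracket_swap12: "jacobian_bracket g f h = - jacobian_bracket f g h"
  by (simp add: jacobian_bracket_expand algebra_simps)

lemma jacobian_bracket_swap23: "jacobian_bracket f h g = - jacobian_bracket f g h"
  by (simp add: jacobian_bracket_expand algebra_simps)

lemma jacobian_bracket_mult:
  "jacobian_bracket (f * f') g h = f * jacobian_bracket f' g h + jacobian_bracket f g h * f'"
  by (simp add: jacobian_bracket_expand pdiff_simps algebra_simps)

text \<open>Scaling is multiplication by a constant, so in the Leibniz rule the term that
  differentiates the constant vanishes.\<close>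

lemma jacobian_bracket_scale3: "jacobian_bracket (scale3 c f) g h = scale3 c (jacobian_bracket f g h)"
  by (simp add: scale3_def jacobian_bracket_mult)
    (simp add: jacobian_bracket_expand pdiff_single_0)

lemma pdiff_var: "pdiff v (var w) = (if v = w then 1 else 0)"
  by (simp add: var_def pdiff_single lookup_single when_def)

lemma jacobian_bracket_var: "jacobian_bracket (var 1) (var 2) (var 3) = 1"
  by (simp add: jacobian_bracket_expand pdiff_var)

definition vfield :: "poly3 \<Rightarrow> poly3 \<Rightarrow> poly3 \<Rightarrow> poly3 \<Rightarrow> poly3" where
  "vfield u v w f = u * pdiff 1 f + v * pdiff 2 f + w * pdiff 3 f"

text \<open>Applying the field to one of the functions replaces its gradient row \<open>r\<close> by
  \<open>X r + r D\<close>, where \<open>D\<close> holds the partial derivatives of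
  \<open>u\<close>, \<open>v\<close>, \<open>w\<close>. Summed over the rows, the \<open>X r\<close>
  parts give \<open>X\<close> of the determinant and the \<open>r D\<close> parts give the trace of
  \<open>D\<close> times it.\<close>

lemma vfield_jacobian_bracket:
  "jacobian_bracket (vfield u v w f) g h + jacobian_bracket f (vfield u v w g) h
    + jacobian_bracket f g (vfield u v w h) =
    vfield u v w (jacobian_bracket f g h)
    + (pdiff 1 u + pdiff 2 v + pdiff 3 w) * jacobian_bracket f g h"
  \<comment> \<open>The oriented instances of \<open>pdiff_commute\<close> put the smaller index
    outermost, so that equal mixed derivatives become identical terms.\<close>
  unfolding jacobian_bracket_expand vfield_def pdiff_simps
    pdiff_commute[of 2 1] pdiff_commute[of 3 1] pdiff_commute[of 3 2]
  by algebra

lemma jacobian_bracket_fundamental: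
  "jacobian_bracket a b (jacobian_bracket f g h) =
    jacobian_bracket (jacobian_bracket a b f) g h + jacobian_bracket f (jacobian_bracket a b g) h
    + jacobian_bracket f g (jacobian_bracket a b h)"
proof -
  \<comment> \<open>The components of the cross product of the gradients of \<open>a\<close> and
    \<open>b\<close>; its scalar product with the gradient of \<open>h\<close> is the bracket of
    \<open>a\<close>, \<open>b\<close>, \<open>h\<close>.\<close>
  define u where "u = pdiff 2 a * pdiff 3 b - pdiff 3 a * pdiff 2 b"
  define v where "v = pdiff 3 a * pdiff 1 b - pdiff 1 a * pdiff 3 b"
  define w where "w = pdiff 1 a * pdiff 2 b - pdiff 2 a * pdiff 1 b"
  have field: "jacobian_bracket a b = vfield u v w"
    by (simp add: fun_eq_iff vfield_def u_def v_def w_def jacobian_bracket_expand algebra_simps)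
  have "pdiff 1 u + pdiff 2 v + pdiff 3 w = 0"
    unfolding u_def v_def w_def pdiff_simps
      pdiff_commute[of 2 1] pdiff_commute[of 3 1] pdiff_commute[of 3 2]
    by algebra
  then show ?thesis
    using vfield_jacobian_bracket[of u v w f g h] by (simp add: field)
qed

theorem theorem4p5:
  fixes \<alpha> :: "poly3 \<Rightarrow> poly3"
  assumes "Vector_Spaces.linear scale3 scale3 \<alpha>"
    and "\<alpha> 1 = 1"
    and "\<And>f g. \<alpha> (f * g) = \<alpha> f * \<alpha> g"
    and "\<And>f g h. \<alpha> (jacobian_bracket f g h) = jacobian_bracket (\<alpha> f) (\<alpha> g) (\<alpha> h)"
  shows "ternary_hom_nambu_poisson scale3
           (\<lambda>f g. \<alpha> (f * g)) (\<lambda>f g h. \<alpha> (jacobian_bracket f g h)) \<alpha>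
         \<and> 1 - det (jacobian_matrix (\<alpha> (var 1)) (\<alpha> (var 2)) (\<alpha> (var 3))) = 0"
proof
  interpret Vector_Spaces.linear scale3 scale3 \<alpha> by (fact assms(1))
  note mult = assms(3) and bracket = assms(4)
  have scale_mult: "scale3 c f * g = scale3 c (f * g)" for c f g
    by (simp add: scale3_def mult.assoc)
  show "ternary_hom_nambu_poisson scale3
      (\<lambda>f g. \<alpha> (f * g)) (\<lambda>f g h. \<alpha> (jacobian_bracket f g h)) \<alpha>"
  proof (intro ternary_hom_nambu_poisson.intro ternary_hom_nambu_poisson_axioms.intro)
    show "vector_space scale3" by (fact vector_space_scale3)
    show "Vector_Spaces.linear scale3 scale3 \<alpha>" by (fact assms(1))
    show "Vector_Spaces.linear scale3 scale3 (\<lambda>f. \<alpha> (f * g))" for g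
      unfolding Vector_Spaces.linear_iff
      by (simp add: vector_space_scale3 distrib_right add scale_mult scale)
    show "Vector_Spaces.linear scale3 scale3 (\<lambda>f. \<alpha> (jacobian_bracket f g h))" for g h
      unfolding Vector_Spaces.linear_iff
      by (simp only: vector_space_scale3 jacobian_bracket_add jacobian_bracket_scale3 add scale) simp
    show "\<alpha> (jacobian_bracket g f h) = - \<alpha> (jacobian_bracket f g h)" for f g h
      by (simp only: jacobian_bracket_swap12[of g f] neg)
    show "\<alpha> (jacobian_bracket f h g) = - \<alpha> (jacobian_bracket f g h)" for f g h
      by (simp only: jacobian_bracket_swap23[of f h] neg)
    show "\<alpha> (f * g) = \<alpha> (g * f)" for f g
      by (simp add: mult.commute)
    \<comment> \<open>Both sides equal \<open>\<alpha> (\<alpha> (f * g * h))\<close>.\<close>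
    show "\<alpha> (\<alpha> f * \<alpha> (g * h)) = \<alpha> (\<alpha> (f * g) * \<alpha> h)" for f g h
      by (simp add: mult mult.assoc)
    show "\<alpha> (jacobian_bracket (\<alpha> a) (\<alpha> b) (\<alpha> (jacobian_bracket f g h))) =
        \<alpha> (jacobian_bracket (\<alpha> (jacobian_bracket a b f)) (\<alpha> g) (\<alpha> h))
        + \<alpha> (jacobian_bracket (\<alpha> f) (\<alpha> (jacobian_bracket a b g)) (\<alpha> h))
        + \<alpha> (jacobian_bracket (\<alpha> f) (\<alpha> g) (\<alpha> (jacobian_bracket a b h)))" for a b f g h
      \<comment> \<open>Read from right to left, \<open>bracket\<close> pulls
        \<open>\<alpha>\<close> out of every term, leaving the untwisted identity under two
        applications of \<open>\<alpha>\<close>.\<close>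
      by (simp only: jacobian_bracket_fundamental[of a b] add flip: bracket)
    show "\<alpha> (jacobian_bracket (\<alpha> (f * f')) (\<alpha> g) (\<alpha> h)) =
        \<alpha> (\<alpha> f * \<alpha> (jacobian_bracket f' g h)) + \<alpha> (\<alpha> (jacobian_bracket f g h) * \<alpha> f')"
      for f f' g h
      by (simp only: jacobian_bracket_mult add flip: bracket mult)
  qed
  have "det (jacobian_matrix (\<alpha> (var 1)) (\<alpha> (var 2)) (\<alpha> (var 3))) =
      \<alpha> (jacobian_bracket (var 1) (var 2) (var 3))"
    unfolding bracket by (simp only: jacobian_bracket_def)
  also have "\<dots> = 1"
    by (simp only: jacobian_bracket_var assms(2))
  finally show "1 - det (jacobian_matrix (\<alpha> (var 1)) (\<alpha> (var 2)) (\<alpha> (var 3))) = 0"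
    by simp
qed

end
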